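(* Let $H_n$ be a random histogram transform with bin widths in $[\underline h_{0,n},\overline h_{0,n}]$, where $\underline h_{0,n}$ and $\overline h_{0,n}$ are of the same order, i.e. $c_{0,n}\overline h_{0,n}\le\underline h_{0,n}\le c_{0,n}^{-1}\overline h_{0,n}$ with constants $c_{0,n}\in(0,1)$ bounded away from $0$. Let the density $f$ of $\mathrm P$ satisfy $f\in C^{1,\alpha}(B_r)$, $\alpha\in(0,1]$, with constant $c_L$. For fixed constants $\underline c_f',\underline c_f,\overline c_f\in(0,\infty)$ let $$\mathcal A_f:=\Bigl\{x\in\mathbb R^d:\Bigl|\frac{\partial f(x)}{\partial x_i}\Bigr|\ge\underline c_f'\text{ for all }i=1,\dots,d\text{ and }f(x)\in[\underline c_f,\overline c_f]\Bigr\}.$$ Choose $\overline h_{0,n}:=n^{-\frac1{2+d}}$ and let $$N_0:=\min\Bigl\{n\in\mathbb N:\overline h_{0,n}\le\min\Bigl\{\Bigl(\frac{\sqrt d\,\underline c_f'c_{0,n}}{4\sqrt3\,c_L}\Bigr)^{\frac1\alpha},\Bigl(\frac{d\sqrt d}{2}\Bigr)^{\frac1\alpha},\frac{\underline c_f}{2d\sqrt d\,c_L},\Bigl(\frac1{4\overline c_f}\Bigr)^{\frac1d}\Bigr\}\Bigr\}.$$ Then for all $n>N_0$ and all $x\in B^+_{r,\sqrt d\,\overline h_{0,n}}\cap\mathcal A_f$, $$\Bigl(\mathbb E_{\nu_n}\bigl|f_{\mathrm D,H_n}(x)-f(x)\bigr|^2\Bigr)^{1/2}\gtrsim n^{-\frac1{2+d}},$$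 where $\nu_n=\mathrm P^n\otimes\mathrm P_H$.
   Context: $\mu$ is Lebesgue measure on $\mathbb R^d$; $\mathrm P$ is a probability measure on $\mathbb R^d$ with density $f$ with respect to $\mu$; $X_1,\dots,X_n$ are i.i.d. from $\mathrm P$ and $\mathrm D=\frac1n\sum_{i=1}^n\delta_{X_i}$. For $r>0$, $B_r=[-r,r]^d$, $B_r^c=\mathbb R^d\setminus B_r$, and for $\delta\in(0,r/2)$, $B^+_{r,\delta}=[\delta,r-\delta]^d$; only $n$ with $\sqrt d\,\overline h_{0,n}<r/2$ are considered. $a_n\gtrsim b_n$ means $a_n\ge c\,b_n$ with a constant $c>0$ independent of $n$ and $x$. $f\in C^{1,\alpha}(B_r)$ with constant $c_L\in(0,\infty)$ means: $\|\nabla f\|\le c_L$ on $B_r$ and $\|\nabla f(x)-\nabla f(x')\|\le c_L\|x-x'\|^\alpha$ for all $x,x'\in B_r$. Histogram transform with bin widths in $[\underline h_0,\overline h_0]$: the random affine map $H(x)=R\,S\,x+b$, where $R$ is a uniformly distributed $d\times d$ rotation matrix ($R^\top=R^{-1}$, $\det R=1$), $S=\mathrm{diag}(s_1,\dots,s_d)$ with $\log s_i$ independent and uniform on $[\log(1/\overline h_0),\log(1/\underline h_0)]$, $b$ is uniform on $[0,1]^d$, and $R,S,b$ are independent of each other and of the data. Its law is $\mathrm P_H$. The bin widths are $h_i=1/s_i\in[\underline h_0,\overline h_0]$. Bin of $x$: $A_H(x)=\{x'\in\mathbb R^d:\lfloor H(x')\rfloor=\lfloor H(x)\rfloor\}$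 (coordinatewise floor). $(A_j)_{j\in\mathcal I_H}$ is the partition of $B_r$ consisting of the nonempty intersections of the bins with $B_r$, and $A_0:=B_r^c$. For a probability measure $\mathrm Q$, $f_{\mathrm Q,H}(x)=\mathrm Q(A_j)/\mu(A_j)$ for $x\in A_j$, $j\in\mathcal I_H\cup\{0\}$ (value $0$ on $A_0$). The estimator is $f_{\mathrm D,H}$. *)

theory Defs
  imports "HOL-Probability.Probability"
begin

definition Box :: "real \<Rightarrow> (real^'d::finite) set" where
  "Box r = cbox (\<chi> i. - r) (\<chi> i. r)"

definition Box_plus :: "real \<Rightarrow> real \<Rightarrow> (real^'d::finite) set" where
  "Box_plus r \<delta> = cbox (\<chi> i. \<delta>) (\<chi> i. r - \<delta>)"

text \<open>
  The gradient is taken within the cube, so that only the values of \<open>f\<close> on the closed cube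
  matter; it is unique, because the cube is non-degenerate when \<open>r > 0\<close>.
\<close>
definition C1_holder :: "real \<Rightarrow> real \<Rightarrow> real \<Rightarrow> (real^'d::finite \<Rightarrow> real) \<Rightarrow> bool" where
  "C1_holder r \<alpha> cL f \<longleftrightarrow> (\<exists>g :: real^'d \<Rightarrow> real^'d.
     (\<forall>x\<in>Box r. (f has_derivative (\<lambda>v. g x \<bullet> v)) (at x within Box r)) \<and>
     (\<forall>x\<in>Box r. norm (g x) \<le> cL) \<and>
     (\<forall>x\<in>Box r. \<forall>x'\<in>Box r. norm (g x - g x') \<le> cL * norm (x - x') powr \<alpha>))"

text \<open>The derivative at \<open>t = 0\<close> along the \<open>i\<close>-th axis is the \<open>i\<close>-th partial derivative at \<open>x\<close>.\<close>
definition A_f :: "real \<Rightarrow> real \<Rightarrow> real \<Rightarrow> (real^'d::finite \<Rightarrow> real) \<Rightarrow> (real^'d) set" where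
  "A_f cf' cf_lo cf_hi f = {x.
     (\<forall>i. \<exists>D. ((\<lambda>t. f (x + t *\<^sub>R axis i 1)) has_real_derivative D) (at 0) \<and> cf' \<le> \<bar>D\<bar>) \<and>
     f x \<in> {cf_lo..cf_hi}}"

text \<open>
  A uniformly distributed rotation matrix: the law is carried by the rotation group and invariant
  under left multiplication by rotations, i.e. it is the normalised Haar measure of that (compact)
  group. This determines the law uniquely.
\<close>
definition uniform_rotation :: "(real^'d^'d::finite) measure \<Rightarrow> bool" where
  "uniform_rotation M \<longleftrightarrow>
     prob_space M \<and> sets M = sets borel \<and> (AE R in M. rotation_matrix R) \<and>
     (\<forall>Q. rotation_matrix Q \<longrightarrow> distr M borel (\<lambda>R. Q ** R) = M)"

text \<open>The degenerate interval \<open>a = b\<close>, a null set, carries the point mass.\<close>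
definition uniform_interval :: "real \<Rightarrow> real \<Rightarrow> real measure" where
  "uniform_interval a b = (if a < b then uniform_measure lborel {a..b} else return borel a)"

definition stretch_law :: "real \<Rightarrow> real \<Rightarrow> (real^'d::finite) measure" where
  "stretch_law h_lo h_hi =
     distr (\<Pi>\<^sub>M i\<in>(UNIV :: 'd set). uniform_interval (ln (1 / h_hi)) (ln (1 / h_lo))) borel
       (\<lambda>t. \<chi> i. exp (t i))"

text \<open>The law of the independent triple of rotation, bin scales and translation.\<close>
definition transform_law ::
  "(real^'d^'d::finite) measure \<Rightarrow> real \<Rightarrow> real \<Rightarrow> ((real^'d^'d) \<times> (real^'d) \<times> (real^'d)) measure" where
  "transform_law MR h_lo h_hi =
     MR \<Otimes>\<^sub>M (stretch_law h_lo h_hi \<Otimes>\<^sub>M uniform_measure lborel (cbox 0 (\<chi> i. 1)))"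

definition diag_matrix :: "real^'d::finite \<Rightarrow> real^'d^'d" where
  "diag_matrix s = (\<chi> i j. if i = j then s $ i else 0)"

fun hist_transform :: "(real^'d^'d::finite) \<times> (real^'d) \<times> (real^'d) \<Rightarrow> real^'d \<Rightarrow> real^'d" where
  "hist_transform (R, s, b) x = (R ** diag_matrix s) *v x + b"

definition bin :: "(real^'d::finite \<Rightarrow> real^'d) \<Rightarrow> real^'d \<Rightarrow> (real^'d) set" where
  "bin H x = {x'. \<forall>i. \<lfloor>H x' $ i\<rfloor> = \<lfloor>H x $ i\<rfloor>}"

definition hist_density ::
  "real \<Rightarrow> (real^'d::finite) measure \<Rightarrow> (real^'d \<Rightarrow> real^'d) \<Rightarrow> real^'d \<Rightarrow> real" where
  "hist_density r Q H x =
     (if x \<in> Box r then measure Q (bin H x \<inter> Box r) / measure lborel (bin H x \<inter> Box r) else 0)"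

text \<open>The law of \<open>X I\<close> for a uniformly drawn index \<open>I < n\<close>.\<close>
definition empirical :: "nat \<Rightarrow> (nat \<Rightarrow> real^'d::finite) \<Rightarrow> (real^'d) measure" where
  "empirical n X = distr (uniform_count_measure {..<n}) borel X"

lemma measure_empirical:
  assumes "n > 0" "A \<in> sets borel"
  shows "measure (empirical n X) A = (\<Sum>i<n. measure (return borel (X i)) A) / real n"
proof -
  have "measure (empirical n X) A = measure (uniform_count_measure {..<n}) (X -` A \<inter> {..<n})"
    unfolding empirical_def using assms
    by (subst measure_distr) (auto simp: space_uniform_count_measure measurable_def
        sets_uniform_count_measure)
  also have "\<dots> = real (card (X -` A \<inter> {..<n})) / real n"
    by (subst measure_uniform_count_measure) auto
  also have "real (card (X -` A \<inter> {..<n})) = (\<Sum>i<n. indicator (X -` A) i)"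
    by (simp add: indicator_def sum.If_cases Int_commute Int_def vimage_def conj_commute)
  also have "\<dots> = (\<Sum>i<n. measure (return borel (X i)) A)"
    using assms by (intro sum.cong) (auto simp: measure_return indicator_def)
  finally show ?thesis .
qed

text \<open>
  The data are indexed by \<open>{..<n}\<close>; the second argument of the product is the law of the
  parameters of the histogram transform.
\<close>
definition nu ::
  "nat \<Rightarrow> (real^'d::finite) measure \<Rightarrow> ((real^'d^'d) \<times> (real^'d) \<times> (real^'d)) measure \<Rightarrow>
   ((nat \<Rightarrow> real^'d) \<times> (real^'d^'d) \<times> (real^'d) \<times> (real^'d)) measure" where
  "nu n P PH = (\<Pi>\<^sub>M i\<in>{..<n}. P) \<Otimes>\<^sub>M PH"

text \<open>
  The threshold sample size. The index starts at 1: at \<open>n = 0\<close> the bin width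
  \<open>n powr (- 1 / (2 + d))\<close> would evaluate to 0 and satisfy the inequality spuriously.
\<close>
definition N_0 ::
  "nat \<Rightarrow> real \<Rightarrow> real \<Rightarrow> real \<Rightarrow> real \<Rightarrow> real \<Rightarrow> (nat \<Rightarrow> real) \<Rightarrow> (nat \<Rightarrow> real) \<Rightarrow> nat" where
  "N_0 d \<alpha> cL cf' cf_lo cf_hi c0 h_hi = (LEAST n. 1 \<le> n \<and>
     h_hi n \<le> Min {(sqrt (real d) * cf' * c0 n / (4 * sqrt 3 * cL)) powr (1 / \<alpha>),
                   (real d * sqrt (real d) / 2) powr (1 / \<alpha>),
                   cf_lo / (2 * real d * sqrt (real d) * cL),
                   (1 / (4 * cf_hi)) powr (1 / real d)})"

end

theory Submission
  imports Defs
begin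

text \<open>
  The lower bound comes from the sampling error alone. Fix a transform, let \<open>A\<close> be the bin of
  \<open>x\<close>, \<open>m\<close> its volume and \<open>p\<close> its probability. The estimator at \<open>x\<close> is the empirical
  frequency of \<open>A\<close> divided by \<open>m\<close>, so its variance is \<open>p (1 - p) / (n m\<^sup>2)\<close>, and the
  mean-square distance from the number \<open>f x\<close> is at least that variance
  (\<open>mean_square_empirical_frequency_ge\<close>). The bin has diameter at most \<open>sqrt d * h\<close>, where
  \<open>h\<close> is the upper bin width (\<open>bin_subset_cball\<close>), and volume at most \<open>h\<^sup>d\<close>
  (\<open>measure_bin\<close>). Beyond \<open>N_0\<close> the width \<open>h\<close> is so small that the Lipschitz bound keeps
  \<open>f\<close> on \<open>A\<close> within \<open>cf_lo / 2\<close> of \<open>f x\<close>. Then \<open>p\<close> is comparable to \<open>m\<close> and at most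
  \<open>3 / 8\<close>, so the variance is at least a constant times \<open>1 / (n m)\<close>, hence at least a constant
  times \<open>1 / (n h\<^sup>d)\<close>. For \<open>h = n powr (- 1 / (2 + d))\<close> this last quantity equals
  \<open>h\<^sup>2\<close>, the square of the claimed rate.

  The bound is uniform over all transforms that occur with probability one, so it survives
  integration over the transform. Two points need care. The volume of a bin is exactly the product
  of its widths, because Lebesgue measure is invariant under rotations
  (\<open>distr_lborel_orthogonal\<close>, from Vitali's covering theorem). And the squared error must be
  shown to be measurable and almost surely bounded, as otherwise its integral would be 0 by
  convention.
\<close>

section \<open>Rotation invariance of Lebesgue measure\<close>

text \<open>
  An orthogonal map sends balls to balls of the same radius. By Vitali's covering theorem an open set
  is, up to a null set, a countable disjoint union of balls, and injectivity keeps their images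
  disjoint.
\<close>
lemma emeasure_open_le_orthogonal_image:
  fixes f :: "'a::euclidean_space \<Rightarrow> 'a"
  assumes f: "orthogonal_transformation f" and S: "open S"
  shows "emeasure lebesgue S \<le> emeasure lebesgue (f ` S)"
proof -
  \<comment> \<open>The balls inside \<open>S\<close>, as pairs of centre and radius, form a Vitali cover of \<open>S\<close>.\<close>
  let ?K = "{(x, r). 0 < r \<and> ball x r \<subseteq> S}"
  have fine: "\<exists>i. i \<in> ?K \<and> x \<in> ball (fst i) (snd i) \<and> snd i < d" if "x \<in> S" "0 < d" for x and d :: real
  proof -
    obtain e where e: "0 < e" "ball x e \<subseteq> S" using S \<open>x \<in> S\<close> by (rule openE)
    let ?r = "min e (d / 2)"
    have "ball x ?r \<subseteq> ball x e" by (simp add: ball_subset_ball_iff)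
    then show ?thesis using e \<open>0 < d\<close> by (intro exI[of _ "(x, ?r)"]) auto
  qed
  obtain C where C: "countable C" "C \<subseteq> ?K"
    and disj: "pairwise (\<lambda>i j. disjnt (ball (fst i) (snd i)) (ball (fst j) (snd j))) C"
    and null: "negligible (S - (\<Union>i\<in>C. ball (fst i) (snd i)))"
    by (rule Vitali_covering_theorem_balls[of S ?K fst snd, OF fine])
  let ?B = "\<lambda>i. ball (fst i) (snd i)"
  have fB: "f ` ?B i = ball (f (fst i)) (snd i)" for i
    by (rule image_orthogonal_transformation_ball[OF f])
  have dB: "disjoint_family_on ?B C"
    using disj by (auto simp: disjoint_family_on_def pairwise_def disjnt_def)
  have dfB: "disjoint_family_on (\<lambda>i. f ` ?B i) C"
    unfolding disjoint_family_on_def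
  proof (intro ballI impI)
    fix i j assume "i \<in> C" "j \<in> C" "i \<noteq> j"
    then have "?B i \<inter> ?B j = {}" using dB by (auto simp: disjoint_family_on_def)
    then show "f ` ?B i \<inter> f ` ?B j = {}"
      using image_Int[OF orthogonal_transformation_inj[OF f], of "?B i" "?B j"] by simp
  qed
  have vol: "emeasure lebesgue (f ` ?B i) = emeasure lebesgue (?B i)" if "i \<in> C" for i
    using that C(2) unfolding fB by (auto simp: emeasure_ball)
  have "open (\<Union>i\<in>C. ?B i)" by auto
  then have UB: "(\<Union>i\<in>C. ?B i) \<in> sets lebesgue" by auto
  then have "emeasure lebesgue S \<le> emeasure lebesgue ((\<Union>i\<in>C. ?B i) \<union> (S - (\<Union>i\<in>C. ?B i)))"
    using null by (intro emeasure_mono sets.Un) (auto simp: negligible_iff_null_sets)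
  also have "\<dots> = emeasure lebesgue (\<Union>i\<in>C. ?B i)"
    using null UB by (intro emeasure_Un_null_set) (auto simp: negligible_iff_null_sets)
  also have "\<dots> = (\<integral>\<^sup>+i. emeasure lebesgue (?B i) \<partial>count_space C)"
    by (rule emeasure_UN_countable[OF _ C(1) dB]) auto
  also have "\<dots> = (\<integral>\<^sup>+i. emeasure lebesgue (f ` ?B i) \<partial>count_space C)"
    using vol by (intro nn_integral_cong) simp
  also have "\<dots> = emeasure lebesgue (\<Union>i\<in>C. f ` ?B i)"
    by (rule emeasure_UN_countable[OF _ C(1) dfB, symmetric]) (auto simp: fB)
  also have "\<dots> \<le> emeasure lebesgue (f ` S)"
  proof (rule emeasure_mono)
    show "(\<Union>i\<in>C. f ` ?B i) \<subseteq> f ` S" using C(2) by fastforce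
    have "open (f ` S)"
      by (rule open_surjective_linear_image[OF S orthogonal_transformation_linear[OF f]
            orthogonal_transformation_surj[OF f]])
    then show "f ` S \<in> sets lebesgue" by auto
  qed
  finally show ?thesis .
qed

text \<open>
  The previous inequality for the map and for its inverse gives equality on open boxes, and these
  determine Lebesgue measure.
\<close>
lemma distr_lborel_orthogonal:
  fixes f :: "'a::euclidean_space \<Rightarrow> 'a"
  assumes f: "orthogonal_transformation f"
  shows "distr lborel borel f = lborel"
proof (rule lborel_eqI[symmetric])
  fix l u :: 'a assume lu: "\<And>b. b \<in> Basis \<Longrightarrow> l \<bullet> b \<le> u \<bullet> b"
  note bij = orthogonal_transformation_bij[OF f]
  note inv = orthogonal_transformation_inv[OF f]
  have cont: "continuous_on UNIV f"
    by (rule linear_continuous_on[OF orthogonal_transformation_linear[OF f, unfolded linear_conv_bounded_linear]])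
  have meas: "f \<in> borel_measurable borel" by (rule borel_measurable_continuous_onI[OF cont])
  have pre: "f -` box l u = inv f ` box l u" using bij by (rule bij_vimage_eq_inv_image)
  have op: "open (f -` box l u)" using cont by (intro open_vimage open_box)
  have "emeasure lebesgue (f -` box l u) = emeasure lebesgue (box l u)"
  proof (rule antisym)
    show "emeasure lebesgue (f -` box l u) \<le> emeasure lebesgue (box l u)"
      using emeasure_open_le_orthogonal_image[OF f op] bij
      by (simp add: surj_image_vimage_eq bij_is_surj)
    show "emeasure lebesgue (box l u) \<le> emeasure lebesgue (f -` box l u)"
      unfolding pre by (rule emeasure_open_le_orthogonal_image[OF inv open_box])
  qed
  then have "emeasure lborel (f -` box l u) = emeasure lborel (box l u)"
    using op by simp
  then show "emeasure (distr lborel borel f) (box l u) = (\<Prod>b\<in>Basis. (u - l) \<bullet> b)"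
    using meas lu by (simp add: emeasure_distr emeasure_lborel_box)
qed simp

section \<open>Measurability of vector components\<close>

lemma measurable_vec_nth [measurable (raw)]:
  fixes f :: "'a \<Rightarrow> ('b::topological_space)^'n::finite"
  assumes "f \<in> M \<rightarrow>\<^sub>M borel"
  shows "(\<lambda>x. f x $ i) \<in> M \<rightarrow>\<^sub>M borel"
  using measurable_compose[OF assms borel_measurable_continuous_onI[of "\<lambda>v. v $ i"]]
  by (simp add: continuous_on_component)

lemma measurable_vec_lambda [measurable (raw)]:
  fixes f :: "'a \<Rightarrow> 'n::finite \<Rightarrow> real"
  assumes "\<And>i. (\<lambda>x. f x i) \<in> borel_measurable M"
  shows "(\<lambda>x. \<chi> i. f x i) \<in> borel_measurable M"
  using assms by (subst borel_measurable_euclidean_space) (auto simp: Basis_vec_def inner_axis)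

section \<open>Geometry of the bins\<close>

lemma hist_transform_nth:
  "hist_transform w x $ i =
    (\<Sum>j\<in>UNIV. fst w $ i $ j * fst (snd w) $ j * x $ j) + snd (snd w) $ i"
proof -
  have "(R ** diag_matrix s) $ i $ j = R $ i $ j * s $ j" for R and s :: "real^'a" and j
    by (simp add: matrix_matrix_mult_def diag_matrix_def if_distrib cong: if_cong)
  then show ?thesis
    by (cases w) (simp add: matrix_vector_mult_def)
qed

lemma sets_bin [measurable]: "bin (hist_transform w) x \<in> sets borel"
proof -
  have "{v \<in> space borel. \<forall>i. \<lfloor>hist_transform w v $ i\<rfloor> = \<lfloor>hist_transform w x $ i\<rfloor>} \<in> sets borel"
    unfolding hist_transform_nth by measurable
  then show ?thesis by (simp add: bin_def)
qed

lemma norm_vec_le_sqrt_card: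
  fixes v :: "real^'d::finite"
  assumes "\<And>i. \<bar>v $ i\<bar> \<le> c"
  shows "norm v \<le> sqrt (real CARD('d)) * c"
proof -
  have c: "0 \<le> c" using assms[of undefined] by linarith
  have "(\<Sum>i\<in>UNIV. (v $ i)\<^sup>2) \<le> (\<Sum>i\<in>(UNIV::'d set). c\<^sup>2)"
    by (intro sum_mono) (metis assms power2_abs power_mono abs_ge_zero)
  then have "norm v \<le> sqrt (real CARD('d) * c\<^sup>2)"
    by (simp add: norm_vec_def L2_set_def)
  then show ?thesis using c by (simp add: real_sqrt_mult)
qed

text \<open>
  A rotation does not change the length of the stretched vector, whose coordinates have grown by a
  factor of at least \<open>m\<close>.
\<close>
lemma norm_matrix_diag_ge:
  fixes R :: "real^'d^'d::finite"
  assumes R: "orthogonal_matrix R" and s: "\<And>i. m \<le> s $ i" and m: "0 \<le> m"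
  shows "m * norm v \<le> norm ((R ** diag_matrix s) *v v)"
proof -
  let ?w = "diag_matrix s *v v"
  have w: "?w $ i = s $ i * v $ i" for i
    by (simp add: matrix_vector_mult_def diag_matrix_def if_distrib[of "\<lambda>a. a * _"] cong: if_cong)
  have "m * norm v = norm (m *\<^sub>R v)" using m by simp
  also have "\<dots> \<le> norm ?w"
    by (rule norm_le_componentwise_cart)
       (use s m in \<open>simp add: w abs_mult mult_right_mono order_trans[OF _ abs_ge_self]\<close>)
  also have "\<dots> = norm (R *v ?w)"
    using R by (metis orthogonal_transformation_matrix orthogonal_transformation_norm
        matrix_of_matrix_vector_mul matrix_vector_mul_linear)
  finally show ?thesis by (simp add: matrix_vector_mul_assoc)
qed

text \<open>
  Two points of a bin have images in one unit cell, hence at distance at most \<open>sqrt d\<close>, and the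
  transform expands distances at least by the factor \<open>1 / h\<close>.
\<close>
lemma bin_subset_cball:
  fixes R :: "real^'d^'d::finite"
  assumes R: "orthogonal_matrix R" and s: "\<And>i. 1 / h \<le> s $ i" and h: "0 < h"
  shows "bin (hist_transform (R, s, b)) x \<subseteq> cball x (sqrt (real CARD('d)) * h)"
proof
  fix y assume y: "y \<in> bin (hist_transform (R, s, b)) x"
  let ?M = "R ** diag_matrix s"
  have "norm (?M *v (y - x)) \<le> sqrt (real CARD('d)) * 1"
  proof (rule norm_vec_le_sqrt_card)
    fix i
    have "\<lfloor>(?M *v y + b) $ i\<rfloor> = \<lfloor>(?M *v x + b) $ i\<rfloor>"
      using y by (auto simp: bin_def)
    then have "\<bar>(?M *v y + b) $ i - (?M *v x + b) $ i\<bar> \<le> 1" by linarith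
    then show "\<bar>(?M *v (y - x)) $ i\<bar> \<le> 1"
      by (simp add: matrix_vector_mult_diff_distrib)
  qed
  with norm_matrix_diag_ge[OF R s, of "y - x"] h
  have "1 / h * norm (y - x) \<le> sqrt (real CARD('d))" by force
  with h show "y \<in> cball x (sqrt (real CARD('d)) * h)"
    by (simp add: dist_norm norm_minus_commute field_simps)
qed

text \<open>
  The bin is the preimage of a unit cell under a stretching, a rotation and a translation. Only the
  stretching changes the volume.
\<close>
lemma measure_bin:
  fixes R :: "real^'d^'d::finite"
  assumes R: "orthogonal_matrix R" and s: "\<And>i. 0 < s $ i"
  shows "measure lborel (bin (hist_transform (R, s, b)) x) = (\<Prod>i\<in>UNIV. 1 / s $ i)"
proof -
  let ?B = "bin (hist_transform (R, s, b)) x"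
  \<comment> \<open>\<open>k\<close> is the lower corner of the unit cell of \<open>x\<close>, shifted back by the translation \<open>b\<close>.\<close>
  define k :: "real^'d" where "k = (\<chi> i. of_int \<lfloor>hist_transform (R, s, b) x $ i\<rfloor> - b $ i)"
  define C where "C = {y. \<forall>i. k $ i \<le> y $ i \<and> y $ i < k $ i + 1}"
  define T where "T = {y. R *v y \<in> C}"
  have C: "C \<in> sets borel"
  proof -
    have "{y \<in> space borel. \<forall>i. k $ i \<le> y $ i \<and> y $ i < k $ i + 1} \<in> sets borel" by measurable
    then show ?thesis by (simp add: C_def)
  qed
  have cell: "emeasure lborel C = 1"
  proof (rule antisym)
    have sub: "box k (k + 1) \<subseteq> C" "C \<subseteq> cbox k (k + 1)"
      by (auto simp: C_def mem_box_cart less_imp_le)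
    have one: "emeasure lborel (cbox k (k + 1)) = 1"
    proof -
      have "measure lborel (cbox k (k + 1)) = 1"
        using content_cbox_cart[of k "k + 1"] by (simp add: interval_ne_empty_cart)
      then show ?thesis
        by (subst emeasure_eq_ennreal_measure) (use emeasure_lborel_cbox_finite[of k "k + 1"] in auto)
    qed
    show "emeasure lborel C \<le> 1" using emeasure_mono[OF sub(2), of lborel] one by simp
    show "1 \<le> emeasure lborel C"
      using emeasure_mono[OF sub(1), of lborel] C one
      by (simp add: emeasure_lborel_box_eq emeasure_lborel_cbox_eq del: inner_simps)
  qed
  have orth: "orthogonal_transformation (\<lambda>v. R *v v)"
    using R by (simp add: orthogonal_transformation_matrix matrix_of_matrix_vector_mul)
  have meas: "(\<lambda>v. R *v v) \<in> borel_measurable borel"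
    by (intro borel_measurable_continuous_onI continuous_intros)
  have T: "T \<in> sets borel"
    using measurable_sets[OF meas C] by (simp add: T_def vimage_def)
  have cell_T: "emeasure lborel T = 1"
    using arg_cong[OF distr_lborel_orthogonal[OF orth], of "\<lambda>M. emeasure M C"] C cell meas
    by (simp add: emeasure_distr T_def vimage_def)
  have B_iff: "v \<in> ?B \<longleftrightarrow> (\<chi> i. s $ i * v $ i) \<in> T" for v
  proof -
    have "diag_matrix s *v v = (\<chi> i. s $ i * v $ i)"
      by (simp add: vec_eq_iff matrix_vector_mult_def diag_matrix_def if_distrib[of "\<lambda>a. a * _"] cong: if_cong)
    then have "hist_transform (R, s, b) v = R *v (\<chi> i. s $ i * v $ i) + b"
      by (simp flip: matrix_vector_mul_assoc)
    then show ?thesis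
      unfolding bin_def T_def C_def k_def
      by (simp only: mem_Collect_eq vec_lambda_beta) (simp add: floor_eq_iff algebra_simps)
  qed
  have nz: "s $ i \<noteq> 0" for i using s[of i] by simp
  have "?B = (\<lambda>v. \<chi> i. (1 / s $ i) * v $ i) ` T"
  proof (intro equalityI subsetI)
    fix v assume "v \<in> ?B"
    then show "v \<in> (\<lambda>v. \<chi> i. (1 / s $ i) * v $ i) ` T"
      using B_iff nz by (intro image_eqI[of _ _ "\<chi> i. s $ i * v $ i"]) (auto simp: vec_eq_iff)
  qed (use B_iff nz in auto)
  moreover have "T \<in> lmeasurable" "measure lebesgue T = 1"
    using T cell_T by (auto simp: fmeasurable_def measure_def)
  ultimately have "measure lebesgue ?B = (\<Prod>i\<in>UNIV. 1 / s $ i)"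
    using measure_stretch[of T "\<lambda>i. 1 / s $ i"] s by (simp add: abs_of_nonneg prod_nonneg less_imp_le)
  then show ?thesis by simp
qed

text \<open>
  The margin in \<open>Box_plus\<close> keeps every bin of a point of that box away from the boundary of
  the cube, where it would be cut off.
\<close>
lemma cball_subset_Box:
  assumes x: "x \<in> Box_plus r \<delta>" and \<delta>: "0 \<le> \<delta>"
  shows "cball x \<delta> \<subseteq> Box r"
proof
  fix y assume y: "y \<in> cball x \<delta>"
  have "\<bar>y $ i - x $ i\<bar> \<le> \<delta>" for i
    using component_le_norm_cart[of "y - x" i] y by (simp add: dist_norm norm_minus_commute)
  then have "y $ i \<le> x $ i + \<delta> \<and> x $ i - \<delta> \<le> y $ i" for i by (smt (verit))
  moreover have "\<delta> \<le> x $ i \<and> x $ i \<le> r - \<delta>" for i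
    using x by (simp add: Box_plus_def mem_box_cart)
  ultimately show "y \<in> Box r" using \<delta> by (simp add: Box_def mem_box_cart) (smt (verit))
qed

section \<open>Law of the random transform\<close>

lemma AE_pair_snd:
  assumes N: "sigma_finite_measure N" and Q: "AE y in N. Q y"
  shows "AE z in M \<Otimes>\<^sub>M N. Q (snd z)"
proof -
  interpret N: sigma_finite_measure N by fact
  obtain A where A: "{y \<in> space N. \<not> Q y} \<subseteq> A" "emeasure N A = 0" "A \<in> sets N"
    using Q by (rule AE_E)
  then show ?thesis
    by (intro AE_I[of _ _ "space M \<times> A"])
       (auto simp: space_pair_measure N.emeasure_pair_measure_Times)
qed

lemma AE_pair_fst:
  assumes N: "prob_space N" and Q: "AE x in M. Q x"
  shows "AE z in M \<Otimes>\<^sub>M N. Q (fst z)"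
proof (rule AE_distrD[where M' = M and f = fst and P = Q])
  show "AE x in distr (M \<Otimes>\<^sub>M N) M fst. Q x"
    unfolding prob_space.distr_pair_fst[OF N] by (rule Q)
qed simp

lemma prob_space_uniform_interval:
  assumes "a \<le> b" shows "prob_space (uniform_interval a b)"
proof (cases "a < b")
  case True
  then show ?thesis by (auto simp: uniform_interval_def intro!: prob_space_uniform_measure)
next
  case False
  then show ?thesis by (simp add: uniform_interval_def prob_space_return)
qed

lemma sets_uniform_interval [measurable_cong]: "sets (uniform_interval a b) = sets borel"
  by (simp add: uniform_interval_def)

lemma AE_uniform_interval:
  assumes "a \<le> b" shows "AE t in uniform_interval a b. t \<in> {a..b}"
proof (cases "a < b")
  case True
  have "AE t in uniform_measure lborel {a..b}. t \<in> {a..b}" by (rule AE_uniform_measureI) auto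
  then show ?thesis using True unfolding uniform_interval_def by presburger
next
  case False
  with assms show ?thesis
    unfolding uniform_interval_def by (simp only: if_False) (subst AE_return, auto)
qed

lemma sets_stretch_law [simp, measurable_cong]: "sets (stretch_law a b) = sets borel"
  by (simp add: stretch_law_def)

lemma measurable_exp_vec:
  "(\<lambda>t. \<chi> i. exp (t i)) \<in> (\<Pi>\<^sub>M i\<in>(UNIV :: 'd::finite set). uniform_interval a b) \<rightarrow>\<^sub>M
    (borel :: (real^'d) measure)"
  by measurable

lemma
  fixes h_lo h_hi :: real
  assumes "0 < h_lo" "h_lo \<le> h_hi"
  shows prob_space_stretch_law: "prob_space (stretch_law h_lo h_hi :: (real^'d::finite) measure)"
    and AE_stretch_law:
      "AE s in (stretch_law h_lo h_hi :: (real^'d) measure). \<forall>i. 1 / h_hi \<le> s $ i \<and> s $ i \<le> 1 / h_lo"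
proof -
  let ?U = "uniform_interval (ln (1 / h_hi)) (ln (1 / h_lo))"
  have le: "ln (1 / h_hi) \<le> ln (1 / h_lo)" using assms by (simp add: frac_le)
  note U = prob_space_uniform_interval[OF le]
  show "prob_space (stretch_law h_lo h_hi :: (real^'d) measure)"
    unfolding stretch_law_def
    by (intro prob_space.prob_space_distr prob_space_PiM U measurable_exp_vec)
  have log_range: "AE t in (\<Pi>\<^sub>M i\<in>(UNIV::'d set). ?U). \<forall>i\<in>UNIV. t i \<in> {ln (1 / h_hi)..ln (1 / h_lo)}"
    by (intro AE_finite_allI AE_PiM_component[OF U] AE_uniform_interval le) auto
  have exp_range: "1 / h_hi \<le> exp u \<and> exp u \<le> 1 / h_lo" if "u \<in> {ln (1 / h_hi)..ln (1 / h_lo)}" for u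
  proof -
    have "exp (ln (1 / h_hi)) \<le> exp u \<and> exp u \<le> exp (ln (1 / h_lo))" using that by simp
    then show ?thesis using assms by simp
  qed
  from log_range have ae: "AE t in (\<Pi>\<^sub>M i\<in>(UNIV::'d set). ?U).
      \<forall>i. 1 / h_hi \<le> (\<chi> i. exp (t i) :: real^'d) $ i \<and> (\<chi> i. exp (t i) :: real^'d) $ i \<le> 1 / h_lo"
    by eventually_elim (use exp_range in simp)
  show "AE s in (stretch_law h_lo h_hi :: (real^'d) measure). \<forall>i. 1 / h_hi \<le> s $ i \<and> s $ i \<le> 1 / h_lo"
    unfolding stretch_law_def by (subst AE_distr_iff[OF measurable_exp_vec]) (use ae in simp_all)
qed

lemma prob_space_unit_cube: "prob_space (uniform_measure lborel (cbox 0 (\<chi> i. 1) :: (real^'d::finite) set))"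
proof (rule prob_space_uniform_measure)
  have "measure lborel (cbox 0 (\<chi> i. 1) :: (real^'d) set) = 1"
    by (subst content_cbox_cart) (auto simp: interval_ne_empty_cart)
  then show "emeasure lborel (cbox 0 (\<chi> i. 1) :: (real^'d) set) \<noteq> 0"
    by (auto simp: measure_def)
  show "emeasure lborel (cbox 0 (\<chi> i. 1) :: (real^'d) set) \<noteq> \<infinity>"
    using emeasure_lborel_cbox_finite by (metis less_irrefl infinity_ennreal_def)
qed

text \<open>
  Almost surely the linear part of the transform is a rotation composed with a stretching by factors
  between \<open>1 / h_hi\<close> and \<open>1 / h_lo\<close>, which is what the geometry of the bins needs.
\<close>
lemma
  fixes MR :: "(real^'d^'d::finite) measure" and h_lo h_hi :: real
  assumes MR: "uniform_rotation MR" and h: "0 < h_lo" "h_lo \<le> h_hi"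
  shows prob_space_transform_law: "prob_space (transform_law MR h_lo h_hi)"
    and AE_transform_law: "AE \<omega> in transform_law MR h_lo h_hi. rotation_matrix (fst \<omega>)
      \<and> (\<forall>i. 1 / h_hi \<le> fst (snd \<omega>) $ i \<and> fst (snd \<omega>) $ i \<le> 1 / h_lo)"
proof -
  let ?S = "stretch_law h_lo h_hi :: (real^'d) measure"
  let ?U = "uniform_measure lborel (cbox 0 (\<chi> i. 1) :: (real^'d) set)"
  have pMR: "prob_space MR" and rot: "AE R in MR. rotation_matrix R"
    using MR by (auto simp: uniform_rotation_def)
  note pS = prob_space_stretch_law[OF h, where 'd = 'd]
  note pU = prob_space_unit_cube[where 'd = 'd]
  note pSU = prob_space_pair[OF pS pU]
  show "prob_space (transform_law MR h_lo h_hi)"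
    unfolding transform_law_def by (intro prob_space_pair pMR pSU)
  have "AE \<omega> in transform_law MR h_lo h_hi. rotation_matrix (fst \<omega>)"
    unfolding transform_law_def by (rule AE_pair_fst[OF pSU rot])
  moreover have "AE w in ?S \<Otimes>\<^sub>M ?U. \<forall>i. 1 / h_hi \<le> fst w $ i \<and> fst w $ i \<le> 1 / h_lo"
    by (rule AE_pair_fst[OF pU AE_stretch_law[OF h]])
  then have "AE \<omega> in transform_law MR h_lo h_hi.
      \<forall>i. 1 / h_hi \<le> fst (snd \<omega>) $ i \<and> fst (snd \<omega>) $ i \<le> 1 / h_lo"
    unfolding transform_law_def by (rule AE_pair_snd[OF prob_space_imp_sigma_finite[OF pSU]])
  ultimately show "AE \<omega> in transform_law MR h_lo h_hi. rotation_matrix (fst \<omega>)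
      \<and> (\<forall>i. 1 / h_hi \<le> fst (snd \<omega>) $ i \<and> fst (snd \<omega>) $ i \<le> 1 / h_lo)"
    by eventually_elim simp
qed

lemma sets_transform_law:
  fixes MR :: "(real^'d^'d::finite) measure"
  assumes "uniform_rotation MR"
  shows "sets (transform_law MR h_lo h_hi) = sets (borel \<Otimes>\<^sub>M (borel \<Otimes>\<^sub>M borel))"
  unfolding transform_law_def using assms
  by (intro sets_pair_measure_cong) (auto simp: uniform_rotation_def)

section \<open>Measurability and boundedness of the histogram\<close>

text \<open>
  Membership in the bin is measurable jointly in the transform and the point; sections of this set
  give the measurability of the bin volume as a function of the transform.
\<close>
lemma sets_bin_joint:
  fixes x :: "real^'d::finite"
  shows "{z \<in> space ((borel \<Otimes>\<^sub>M (borel \<Otimes>\<^sub>M borel)) \<Otimes>\<^sub>M borel).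
      snd z \<in> bin (hist_transform (fst z)) x \<inter> Box r}
    \<in> sets ((borel \<Otimes>\<^sub>M (borel \<Otimes>\<^sub>M borel)) \<Otimes>\<^sub>M borel)"
proof -
  have B: "Box r \<in> sets borel" by (simp add: Box_def)
  note [measurable] = B
  show ?thesis
    unfolding bin_def Int_iff mem_Collect_eq hist_transform_nth by measurable
qed

lemma measure_empirical_eq_sum:
  assumes "0 < n" "A \<in> sets borel"
  shows "measure (empirical n X) A = (\<Sum>i<n. indicator A (X i)) / real n"
  using assms by (simp add: measure_empirical measure_return)

text \<open>
  This holds for all transforms, including the degenerate ones outside the support of the law, so
  that the integral over the joint law is the integral of a measurable function in the strict
  sense.
\<close>
lemma measurable_hist_density_empirical:
  fixes P :: "(real^'d::finite) measure"
  assumes n: "0 < n" and P: "sets P = sets borel"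
    and PH: "sets PH = sets (borel \<Otimes>\<^sub>M (borel \<Otimes>\<^sub>M borel))"
  shows "(\<lambda>(X, \<omega>). hist_density r (empirical n X) (hist_transform \<omega>) x) \<in> borel_measurable (nu n P PH)"
proof -
  let ?B = "\<lambda>\<omega>. bin (hist_transform \<omega>) x \<inter> Box r"
  let ?T = "borel \<Otimes>\<^sub>M (borel \<Otimes>\<^sub>M borel) :: ((real^'d^'d) \<times> (real^'d) \<times> (real^'d)) measure"
  have Box: "Box r \<in> sets (borel :: (real^'d) measure)" by (simp add: Box_def)
  have B: "?B \<omega> \<in> sets borel" for \<omega> using Box by (intro sets.Int sets_bin) auto
  have D: "{z. snd z \<in> ?B (fst z)} \<in> sets (?T \<Otimes>\<^sub>M borel)"
    using sets_bin_joint[of x r] by (simp add: space_pair_measure)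
  have nu: "sets (nu n P PH) = sets ((\<Pi>\<^sub>M i\<in>{..<n}. borel) \<Otimes>\<^sub>M ?T)"
    unfolding nu_def by (intro sets_pair_measure_cong sets_PiM_cong) (simp_all add: P PH)
  have "(\<lambda>\<omega>. emeasure lborel (Pair \<omega> -` {z. snd z \<in> ?B (fst z)})) \<in> borel_measurable ?T"
    using D by (intro lborel.measurable_emeasure_Pair) (simp cong: sets_pair_measure_cong)
  then have vol [measurable]: "(\<lambda>\<omega>. measure lborel (?B \<omega>)) \<in> borel_measurable ?T"
    unfolding measure_def by (simp add: vimage_def Int_def)
  have [measurable]: "(\<lambda>p. indicator (?B (snd p)) (fst p i) :: real)
      \<in> borel_measurable ((\<Pi>\<^sub>M i\<in>{..<n}. borel) \<Otimes>\<^sub>M ?T)" if "i < n" for i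
  proof -
    have "(\<lambda>p. (snd p, fst p i)) \<in> (\<Pi>\<^sub>M i\<in>{..<n}. borel) \<Otimes>\<^sub>M ?T \<rightarrow>\<^sub>M ?T \<Otimes>\<^sub>M borel"
      using that by (intro measurable_Pair measurable_snd measurable_compose[OF measurable_fst]
          measurable_component_singleton) simp
    from measurable_compose[OF this borel_measurable_indicator[OF D]]
    show ?thesis by (simp add: indicator_def)
  qed
  have freq: "measure (empirical n X) (?B \<omega>) = (\<Sum>i<n. indicator (?B \<omega>) (X i)) / real n" for X \<omega>
    by (rule measure_empirical_eq_sum[OF n B])
  show ?thesis
    unfolding measurable_cong_sets[OF nu refl] hist_density_def freq case_prod_beta by measurable
qed

lemma hist_density_empirical_le:
  fixes X :: "nat \<Rightarrow> real^'d::finite"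
  assumes n: "0 < n" and m: "0 < m" "m \<le> measure lborel (bin (hist_transform \<omega>) x \<inter> Box r)"
  shows "hist_density r (empirical n X) (hist_transform \<omega>) x \<in> {0..1 / m}"
proof -
  let ?A = "bin (hist_transform \<omega>) x \<inter> Box r"
  have "?A \<in> sets borel" by (auto simp: Box_def)
  then have "measure (empirical n X) ?A = (\<Sum>i<n. indicator ?A (X i)) / real n"
    by (rule measure_empirical_eq_sum[OF n])
  moreover have "(\<Sum>i<n. indicator ?A (X i) :: real) \<le> (\<Sum>i<n. 1)"
    by (intro sum_mono) (simp add: indicator_def)
  ultimately have "measure (empirical n X) ?A \<le> 1" using n by simp
  then show ?thesis
    using m unfolding hist_density_def by (auto intro!: frac_le)
qed

section \<open>Variance of an empirical frequency\<close>

text \<open>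
  The second moment of a sum of centred independent copies is additive because the mixed products
  have expectation 0.
\<close>
lemma (in prob_space) expectation_square_iid_sum:
  fixes g :: "'a \<Rightarrow> real"
  assumes g: "integrable M g" and g2: "integrable M (\<lambda>y. (g y)\<^sup>2)" and mean: "expectation g = 0"
  shows "integrable (\<Pi>\<^sub>M i\<in>{..<n::nat}. M) (\<lambda>X. (\<Sum>i<n. g (X i))\<^sup>2)"
    and "(\<integral>X. (\<Sum>i<n. g (X i))\<^sup>2 \<partial>(\<Pi>\<^sub>M i\<in>{..<n}. M)) = real n * expectation (\<lambda>y. (g y)\<^sup>2)"
    and "i < n \<Longrightarrow> integrable (\<Pi>\<^sub>M i\<in>{..<n}. M) (\<lambda>X. g (X i))"
    and "i < n \<Longrightarrow> (\<integral>X. g (X i) \<partial>(\<Pi>\<^sub>M i\<in>{..<n}. M)) = 0"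
proof -
  let ?P = "\<Pi>\<^sub>M i\<in>{..<n}. M"
  interpret PP: product_sigma_finite "\<lambda>_::nat. M"
    by unfold_locales
  have comp: "distr ?P M (\<lambda>X. X i) = M" if "i < n" for i
    using distr_PiM_component[of "{..<n}" "\<lambda>_. M" i] that prob_space_axioms by auto
  have int: "integrable ?P (\<lambda>X. f (X i))" and eq: "(\<integral>X. f (X i) \<partial>?P) = expectation f"
    if "integrable M f" "i < n" for f :: "'a \<Rightarrow> real" and i
  proof -
    have "integrable (distr ?P M (\<lambda>X. X i)) f" using that comp by simp
    then show "integrable ?P (\<lambda>X. f (X i))"
      by (rule integrable_distr[rotated]) (use that in auto)
    show "(\<integral>X. f (X i) \<partial>?P) = expectation f"
      using integral_distr[of "\<lambda>X. X i" ?P M f] that comp by auto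
  qed
  show "i < n \<Longrightarrow> integrable ?P (\<lambda>X. g (X i))" and "i < n \<Longrightarrow> (\<integral>X. g (X i) \<partial>?P) = 0"
    using int eq g mean by auto
  have pair: "integrable ?P (\<lambda>X. g (X i) * g (X j))
      \<and> (\<integral>X. g (X i) * g (X j) \<partial>?P) = (if i = j then expectation (\<lambda>y. (g y)\<^sup>2) else 0)"
    if ij: "i < n" "j < n" for i j
  proof (cases "i = j")
    case True
    then show ?thesis using int[OF g2 ij(1)] eq[OF g2 ij(1)] by (simp add: power2_eq_square)
  next
    case False
    \<comment> \<open>A mixed product of two coordinates is a product over all coordinates in which the other
      factors are 1, so that its integral factorises.\<close>
    define F where "F = (\<lambda>k y. if k = i \<or> k = j then g y else 1)"
    have sub: "{i, j} \<subseteq> {..<n}" using ij by auto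
    have prod: "(\<Prod>k<n. if k = i \<or> k = j then u k else 1) = u i * u j" for u :: "nat \<Rightarrow> real"
    proof -
      have "(\<Prod>k<n. if k = i \<or> k = j then u k else 1) = (\<Prod>k\<in>{i, j}. u k)"
        using sub by (intro prod.mono_neutral_cong_right) auto
      then show ?thesis using False by simp
    qed
    have F: "integrable M (F k)" for k using g by (cases "k = i \<or> k = j") (simp_all add: F_def)
    have e: "(\<Prod>k<n. F k (X k)) = g (X i) * g (X j)" for X
      unfolding F_def by (rule prod)
    have "(\<Prod>k<n. expectation (F k)) = (\<Prod>k<n. if k = i \<or> k = j then expectation g else 1)"
      by (intro prod.cong) (auto simp: F_def prob_space)
    then have "(\<Prod>k<n. expectation (F k)) = 0" using prod[of "\<lambda>_. expectation g"] mean by simp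
    then show ?thesis
      using PP.product_integrable_prod[of "{..<n}" F] PP.product_integral_prod[of "{..<n}" F] F e False
      by simp
  qed
  have sq: "(\<Sum>i<n. g (X i))\<^sup>2 = (\<Sum>i<n. \<Sum>j<n. g (X i) * g (X j))" for X
    by (simp add: power2_eq_square sum_product)
  show "integrable ?P (\<lambda>X. (\<Sum>i<n. g (X i))\<^sup>2)"
    unfolding sq using pair by (intro Bochner_Integration.integrable_sum) auto
  have "(\<integral>X. (\<Sum>i<n. g (X i))\<^sup>2 \<partial>?P) = (\<Sum>i<n. \<Sum>j<n. \<integral>X. g (X i) * g (X j) \<partial>?P)"
    unfolding sq using pair
    by (subst Bochner_Integration.integral_sum)
       (auto intro!: sum.cong Bochner_Integration.integral_sum Bochner_Integration.integrable_sum)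
  also have "\<dots> = (\<Sum>i<n. \<Sum>j<n. if i = j then expectation (\<lambda>y. (g y)\<^sup>2) else 0)"
    using pair by (intro sum.cong) auto
  finally show "(\<integral>X. (\<Sum>i<n. g (X i))\<^sup>2 \<partial>?P) = real n * expectation (\<lambda>y. (g y)\<^sup>2)"
    by simp
qed

text \<open>
  The mean-square distance of a random variable from a constant \<open>c\<close> is at least its variance,
  whatever \<open>c\<close> is. Here the variable is a scaled empirical frequency, whose variance is that of a
  binomial variable up to the scaling.
\<close>
lemma (in prob_space) mean_square_empirical_frequency_ge:
  fixes m c :: real
  assumes A: "A \<in> sets M" and n: "0 < n" and m: "0 < m"
  shows "prob A * (1 - prob A) / (real n * m\<^sup>2)
    \<le> (\<integral>X. ((\<Sum>i<n. indicator A (X i)) / real n / m - c)\<^sup>2 \<partial>(\<Pi>\<^sub>M i\<in>{..<n}. M))"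
proof -
  let ?P = "\<Pi>\<^sub>M i\<in>{..<n}. M"
  interpret PP: prob_space ?P by (intro prob_space_PiM prob_space_axioms)
  define p where "p = prob A"
  define g where "g = (\<lambda>y. indicator A y - p :: real)"
  define W where "W = (\<lambda>X. \<Sum>i<n. g (X i))"
  define q where "q = p / m - c"
  have intA: "integrable M (indicator A :: 'a \<Rightarrow> real)"
    using A by (simp add: integrable_indicator_iff emeasure_eq_measure)
  have g2: "(g y)\<^sup>2 = (1 - 2 * p) * indicator A y + p\<^sup>2" for y
    by (auto simp: g_def power2_eq_square indicator_def algebra_simps)
  have g: "integrable M g" "integrable M (\<lambda>y. (g y)\<^sup>2)" "expectation g = 0"
    unfolding g2 using intA A by (auto simp: g_def p_def prob_space)
  have var: "expectation (\<lambda>y. (g y)\<^sup>2) = p * (1 - p)"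
    unfolding g2 using intA A 
    by (simp add: prob_space p_def[symmetric] power2_eq_square algebra_simps)
  note iid = expectation_square_iid_sum[OF g, where n = n]
  have W: "integrable ?P W" "(\<integral>X. W X \<partial>?P) = 0"
    unfolding W_def using iid(3,4) by (auto simp: Bochner_Integration.integral_sum)
  \<comment> \<open>Expanding the square around the mean leaves a variance, a centred linear term and a
    squared bias \<open>q\<^sup>2\<close>; the last one is dropped.\<close>
  have Z: "((\<Sum>i<n. indicator A (X i)) / real n / m - c)\<^sup>2
      = (W X)\<^sup>2 / (real n * m)\<^sup>2 + 2 * q / (real n * m) * W X + q\<^sup>2" for X
  proof -
    have "(\<Sum>i<n. indicator A (X i)) / real n / m - c = W X / (real n * m) + q"
      using n m by (simp add: W_def g_def q_def sum_subtractf field_simps)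
    then show ?thesis by (simp add: power2_sum power_divide)
  qed
  have "p * (1 - p) / (real n * m\<^sup>2) = real n * (p * (1 - p)) / (real n * m)\<^sup>2"
    using n m by (simp add: power2_eq_square)
  also have "\<dots> \<le> real n * (p * (1 - p)) / (real n * m)\<^sup>2 + q\<^sup>2" by simp
  also have "\<dots> = (\<integral>X. (W X)\<^sup>2 / (real n * m)\<^sup>2 + 2 * q / (real n * m) * W X + q\<^sup>2 \<partial>?P)"
    using iid(1,2) W var unfolding W_def by (simp add: PP.prob_space)
  finally show ?thesis unfolding Z p_def .
qed

section \<open>Density and sample-size bounds\<close>

text \<open>
  Mean value inequality on the convex cube.
\<close>
lemma C1_holder_lipschitz:
  fixes f :: "real^'d::finite \<Rightarrow> real"
  assumes "C1_holder r \<alpha> cL f" "x \<in> Box r" "y \<in> Box r"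
  shows "\<bar>f y - f x\<bar> \<le> cL * norm (y - x)"
proof -
  obtain g :: "real^'d \<Rightarrow> real^'d" where
    g: "\<And>x. x \<in> Box r \<Longrightarrow> (f has_derivative (\<lambda>v. g x \<bullet> v)) (at x within Box r)"
      "\<And>x. x \<in> Box r \<Longrightarrow> norm (g x) \<le> cL"
    using assms(1) unfolding C1_holder_def by metis
  have "norm (f y - f x) \<le> cL * norm (y - x)"
  proof (rule differentiable_bound[OF _ g(1)])
    show "convex (Box r :: (real^'d) set)" by (simp add: Box_def)
    fix z :: "real^'d" assume "z \<in> Box r"
    then show "onorm (\<lambda>v. g z \<bullet> v) \<le> cL"
      using g(2) by (intro onorm_bound)
        (auto intro: order_trans[OF Cauchy_Schwarz_ineq2] mult_right_mono order_trans[OF norm_ge_zero])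
  qed (use assms in auto)
  then show ?thesis by simp
qed

lemma measure_density_between:
  fixes f :: "'a \<Rightarrow> real"
  assumes [measurable]: "f \<in> borel_measurable M" and prob: "prob_space (density M (\<lambda>x. ennreal (f x)))"
    and A [measurable]: "A \<in> fmeasurable M" and lo: "0 \<le> lo"
    and bounds: "\<And>y. y \<in> A \<Longrightarrow> lo \<le> f y \<and> f y \<le> hi"
  shows "lo * measure M A \<le> measure (density M (\<lambda>x. ennreal (f x))) A"
    and "measure (density M (\<lambda>x. ennreal (f x))) A \<le> hi * measure M A"
proof -
  let ?D = "density M (\<lambda>x. ennreal (f x))"
  interpret D: prob_space ?D by fact
  have hi: "0 \<le> hi \<or> A = {}" using bounds lo by fastforce
  have [measurable]: "A \<in> sets M" using A by (rule fmeasurableD)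
  have eD: "emeasure ?D A = (\<integral>\<^sup>+y. ennreal (f y) * indicator A y \<partial>M)"
    by (subst emeasure_density) auto
  have eM: "emeasure M A = ennreal (measure M A)"
    using A by (rule emeasure_eq_measure2)
  have "ennreal lo * emeasure M A = (\<integral>\<^sup>+y. ennreal lo * indicator A y \<partial>M)"
    by (simp add: nn_integral_cmult_indicator)
  also have "\<dots> \<le> emeasure ?D A"
    unfolding eD using bounds by (intro nn_integral_mono) (auto simp: indicator_def ennreal_leI)
  finally have "ennreal (lo * measure M A) \<le> ennreal (measure ?D A)"
    using lo by (simp add: eM D.emeasure_eq_measure ennreal_mult)
  then show "lo * measure M A \<le> measure ?D A" by (subst (asm) ennreal_le_iff) auto
  show "measure ?D A \<le> hi * measure M A"
  proof (cases "A = {}")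
    case False
    with hi have hi: "0 \<le> hi" by simp
    have "emeasure ?D A \<le> (\<integral>\<^sup>+y. ennreal hi * indicator A y \<partial>M)"
      unfolding eD using bounds by (intro nn_integral_mono) (auto simp: indicator_def ennreal_leI)
    also have "\<dots> = ennreal hi * emeasure M A"
      by (simp add: nn_integral_cmult_indicator)
    finally have "ennreal (measure ?D A) \<le> ennreal (hi * measure M A)"
      using hi by (simp add: eM D.emeasure_eq_measure ennreal_mult)
    then show ?thesis using hi by (subst (asm) ennreal_le_iff) auto
  qed simp
qed

text \<open>
  The threshold index exists because the bandwidths tend to 0, and beyond it the bandwidth is small
  enough for the density to vary little over a bin and for a bin to have probability bounded
  away from 1.
\<close>
lemma N_0_bounds:
  fixes h_hi c0 :: "nat \<Rightarrow> real"
  assumes d: "1 \<le> d" and alpha: "0 < \<alpha>" and cL: "0 < cL" and cf: "0 < cf'" "0 < cf_lo" "0 < cf_hi"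
    and h_hi: "\<And>n. 1 \<le> n \<Longrightarrow> h_hi n = real n powr (- 1 / (2 + real d))"
    and c0: "\<exists>c>0. \<forall>n\<ge>1. c \<le> c0 n"
    and n: "N_0 d \<alpha> cL cf' cf_lo cf_hi c0 h_hi < n"
  shows "1 < n" and "h_hi n \<le> cf_lo / (2 * real d * sqrt (real d) * cL)"
    and "h_hi n ^ d \<le> 1 / (4 * cf_hi)"
proof -
  define T where "T = (\<lambda>n. Min {(sqrt (real d) * cf' * c0 n / (4 * sqrt 3 * cL)) powr (1 / \<alpha>),
                   (real d * sqrt (real d) / 2) powr (1 / \<alpha>),
                   cf_lo / (2 * real d * sqrt (real d) * cL),
                   (1 / (4 * cf_hi)) powr (1 / real d)})"
  define N where "N = N_0 d \<alpha> cL cf' cf_lo cf_hi c0 h_hi"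
  obtain c where c: "0 < c" "\<And>n. 1 \<le> n \<Longrightarrow> c \<le> c0 n" using c0 by blast
  \<comment> \<open>The bounds at \<open>c\<close> instead of \<open>c0 n\<close> give a positive lower estimate of the threshold that
    does not depend on \<open>n\<close>, so the bandwidth falls below the threshold eventually and the least
    index in the definition of \<open>N_0\<close> exists.\<close>
  define \<epsilon> where "\<epsilon> = Min {(sqrt (real d) * cf' * c / (4 * sqrt 3 * cL)) powr (1 / \<alpha>),
                   (real d * sqrt (real d) / 2) powr (1 / \<alpha>),
                   cf_lo / (2 * real d * sqrt (real d) * cL),
                   (1 / (4 * cf_hi)) powr (1 / real d)}"
  have "0 < \<epsilon>" using c d cL cf by (simp add: \<epsilon>_def)
  have T: "\<epsilon> \<le> T n" if "1 \<le> n" for n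
  proof -
    have "(sqrt (real d) * cf' * c / (4 * sqrt 3 * cL)) powr (1 / \<alpha>)
        \<le> (sqrt (real d) * cf' * c0 n / (4 * sqrt 3 * cL)) powr (1 / \<alpha>)"
      using c that d cL cf alpha
      by (intro powr_mono2 divide_right_mono mult_left_mono) (auto intro: less_imp_le)
    then show ?thesis unfolding \<epsilon>_def T_def by (auto simp: min_le_iff_disj)
  qed
  have "(\<lambda>n. real n powr (- 1 / (2 + real d))) \<longlonglongrightarrow> 0"
    by (intro tendsto_neg_powr filterlim_real_sequentially) (simp add: divide_neg_pos)
  then have "\<forall>\<^sub>F n in sequentially. real n powr (- 1 / (2 + real d)) < \<epsilon> \<and> 1 \<le> n"
    using \<open>0 < \<epsilon>\<close> by (intro eventually_conj order_tendstoD(2) eventually_ge_at_top)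
  then obtain n0 where "1 \<le> n0" "real n0 powr (- 1 / (2 + real d)) < \<epsilon>"
    by (auto simp: eventually_sequentially)
  then have "1 \<le> n0 \<and> h_hi n0 \<le> T n0" using h_hi T[of n0] by simp
  then have N: "1 \<le> N" "h_hi N \<le> T N"
    unfolding N_def N_0_def T_def[symmetric] using LeastI[of "\<lambda>n. 1 \<le> n \<and> h_hi n \<le> T n" n0]
    by (auto simp: T_def)
  show n1: "1 < n" using N n by (simp add: N_def)
  \<comment> \<open>The two bounds wanted do not involve \<open>c0\<close>, so they pass from \<open>N\<close> to all larger indices.\<close>
  have mono: "h_hi n \<le> h_hi N"
    using N n1 n by (simp add: h_hi N_def[symmetric] powr_mono2' divide_nonpos_nonneg)
  then show "h_hi n \<le> cf_lo / (2 * real d * sqrt (real d) * cL)" using N by (simp add: T_def)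
  have "h_hi n \<le> (1 / (4 * cf_hi)) powr (1 / real d)" using mono N by (simp add: T_def)
  moreover have "0 \<le> h_hi n" using h_hi n1 by simp
  ultimately have "h_hi n ^ d \<le> ((1 / (4 * cf_hi)) powr (1 / real d)) ^ d" by (intro power_mono)
  also have "\<dots> = 1 / (4 * cf_hi)"
    using d cf by (simp add: powr_realpow[symmetric] powr_powr)
  finally show "h_hi n ^ d \<le> 1 / (4 * cf_hi)" .
qed

section \<open>The lower bound on the mean-square error\<close>

text \<open>
  For a fixed transform the variance of the histogram already has the claimed order. On the bin
  \<open>A\<close> of \<open>x\<close>, of volume \<open>m \<le> h ^ d\<close>, the density lies between \<open>lo / 2\<close> and \<open>3 / 2 * hi\<close>.
  So \<open>prob A\<close> is at least of order \<open>m\<close> and stays below \<open>3 / 8\<close>, which makes the variance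
  \<open>prob A * (1 - prob A) / (n * m\<^sup>2)\<close> at least of order \<open>1 / (n * m)\<close>.
\<close>
lemma mean_square_error_given_transform:
  fixes f :: "real^'d::finite \<Rightarrow> real" and R :: "real^'d^'d"
  assumes f: "f \<in> borel_measurable borel" and P: "P = density lborel (\<lambda>x. ennreal (f x))" "prob_space P"
    and C1: "C1_holder r \<alpha> cL f" and cL: "0 < cL"
    and h: "0 < h" "h \<le> lo / (2 * real CARD('d) * sqrt (real CARD('d)) * cL)"
      "h ^ CARD('d) \<le> 1 / (4 * hi)"
    and x: "x \<in> Box_plus r (sqrt (real CARD('d)) * h)"
    and fx: "0 < lo" "f x \<in> {lo..hi}"
    and n: "0 < n"
    and R: "orthogonal_matrix R" and s: "\<And>i. 1 / h \<le> s $ i"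
  shows "5 / 16 * lo / (real n * h ^ CARD('d))
    \<le> (\<integral>X. \<bar>hist_density r (empirical n X) (hist_transform (R, s, b)) x - f x\<bar>\<^sup>2 \<partial>(\<Pi>\<^sub>M i\<in>{..<n}. P))"
proof -
  interpret P: prob_space P by fact
  define d where "d = real CARD('d)"
  have d: "1 \<le> d" by (simp add: d_def Suc_leI)
  define A where "A = bin (hist_transform (R, s, b)) x"
  define m where "m = measure lborel A"
  have s_pos: "0 < s $ i" for i using s[of i] h(1) by (meson less_le_trans zero_less_divide_1_iff)
  have A_cball: "A \<subseteq> cball x (sqrt d * h)"
    unfolding A_def d_def by (rule bin_subset_cball[OF R s h(1)])
  have cball_Box: "cball x (sqrt d * h) \<subseteq> Box r"
    using x h(1) unfolding d_def by (intro cball_subset_Box) auto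
  have xB: "x \<in> Box r" using cball_Box h(1) d by auto
  have A_Box: "A \<inter> Box r = A" using A_cball cball_Box by blast
  have A: "A \<in> sets borel" unfolding A_def by (rule sets_bin)
  have A_fin: "A \<in> fmeasurable lborel"
    by (rule fmeasurableI2[OF _ A_cball]) (use A emeasure_lborel_cball_finite in \<open>auto simp: fmeasurable_def\<close>)
  have m_eq: "m = (\<Prod>i\<in>UNIV. 1 / s $ i)"
    unfolding m_def A_def by (rule measure_bin[OF R s_pos])
  have m: "0 < m" unfolding m_eq using s_pos by (intro prod_pos) simp
  have "m \<le> (\<Prod>i\<in>(UNIV::'d set). h)"
    unfolding m_eq
  proof (intro prod_mono conjI)
    fix i show "0 \<le> 1 / s $ i" using s_pos[of i] by simp
    show "1 / s $ i \<le> h" using s[of i] s_pos[of i] h(1) by (simp add: field_simps)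
  qed
  then have m_le: "m \<le> h ^ CARD('d)" by simp
  \<comment> \<open>The upper bound on \<open>h\<close> is what makes the oscillation of \<open>f\<close> over a ball of radius
    \<open>sqrt d * h\<close> at most half of the lower bound \<open>lo\<close>.\<close>
  have osc: "lo / 2 \<le> f y \<and> f y \<le> 3 / 2 * hi" if "y \<in> A" for y
  proof -
    have "norm (y - x) \<le> sqrt d * h"
      using that A_cball by (auto simp: dist_norm norm_minus_commute)
    then have "cL * norm (y - x) \<le> cL * (sqrt d * h)" using cL by simp
    also have "\<dots> \<le> cL * (sqrt d * (lo / (2 * d * sqrt d * cL)))"
      using h(2) cL d by (intro mult_left_mono) (auto simp: d_def)
    also have "\<dots> = lo / (2 * d)" using cL d by (simp add: field_simps)
    also have "\<dots> \<le> lo / 2" using d fx(1) by (simp add: field_simps)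
    finally have "\<bar>f y - f x\<bar> \<le> lo / 2"
      using C1_holder_lipschitz[OF C1 xB, of y] that A_Box by force
    moreover have "lo \<le> f x" "f x \<le> hi" using fx(2) by auto
    ultimately show ?thesis by linarith
  qed
  have p_ge: "lo / 2 * m \<le> P.prob A"
    unfolding P(1) m_def
    by (rule measure_density_between(1)[OF _ P(2)[unfolded P(1)] A_fin, where hi = "3 / 2 * hi"])
       (use f fx osc in auto)
  have "P.prob A \<le> 3 / 2 * hi * m"
    unfolding P(1) m_def
    by (rule measure_density_between(2)[OF _ P(2)[unfolded P(1)] A_fin, where lo = "lo / 2"])
       (use f fx osc in auto)
  also have "\<dots> \<le> 3 / 2 * hi * (1 / (4 * hi))"
    using m_le h(3) fx by (intro mult_left_mono) auto
  also have "\<dots> = 3 / 8" using fx by simp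
  finally have p_le: "P.prob A \<le> 3 / 8" .
  \<comment> \<open>The factor 5/16 is half of \<open>1 - 3/8\<close>, from \<open>prob A \<ge> lo / 2 * m\<close> and \<open>prob A \<le> 3 / 8\<close>.\<close>
  have "5 / 16 * lo / (real n * h ^ CARD('d)) \<le> 5 / 16 * lo / (real n * m)"
    using m m_le n fx(1) by (intro divide_left_mono mult_left_mono) auto
  also have "\<dots> = (lo / 2 * m) * (5 / 8) / (real n * m\<^sup>2)"
    using m n by (simp add: power2_eq_square)
  also have "\<dots> \<le> P.prob A * (1 - P.prob A) / (real n * m\<^sup>2)"
    using p_ge p_le m fx(1) by (intro divide_right_mono mult_mono) auto
  also have "\<dots> \<le> (\<integral>X. ((\<Sum>i<n. indicator A (X i)) / real n / m - f x)\<^sup>2 \<partial>(\<Pi>\<^sub>M i\<in>{..<n}. P))"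
    using A n m by (intro P.mean_square_empirical_frequency_ge) (simp_all add: P(1))
  finally show ?thesis
    using xB measure_empirical_eq_sum[OF n A]
    by (simp add: hist_density_def A_def[symmetric] A_Box m_def[symmetric])
qed

theorem theorem9:
  fixes P :: "(real^'d::finite) measure"
    and f :: "real^'d \<Rightarrow> real"
    and MR :: "(real^'d^'d) measure"
    and r \<alpha> cL cf' cf_lo cf_hi :: real
    and h_lo h_hi c0 :: "nat \<Rightarrow> real"
  assumes f_meas: "f \<in> borel_measurable borel"
    and f_nonneg: "\<And>x. 0 \<le> f x"
    and P_density: "P = density lborel (\<lambda>x. ennreal (f x))"
    and P_prob: "prob_space P"
    and r_pos: "0 < r"
    and alpha: "0 < \<alpha>" "\<alpha> \<le> 1"
    and cL_pos: "0 < cL"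
    and f_C1: "C1_holder r \<alpha> cL f"
    and cf_pos: "0 < cf'" "0 < cf_lo" "0 < cf_hi"
    and MR: "uniform_rotation MR"
    and h_hi: "\<And>n. 1 \<le> n \<Longrightarrow> h_hi n = real n powr (- 1 / (2 + real CARD('d)))"
    and h_le: "\<And>n. 1 \<le> n \<Longrightarrow> h_lo n \<le> h_hi n"
    and h_order: "\<And>n. 1 \<le> n \<Longrightarrow> c0 n * h_hi n \<le> h_lo n \<and> h_lo n \<le> inverse (c0 n) * h_hi n"
    and c0_range: "\<And>n. 1 \<le> n \<Longrightarrow> 0 < c0 n \<and> c0 n < 1"
    and c0_away: "\<exists>c>0. \<forall>n\<ge>1. c \<le> c0 n"
  shows "\<exists>c>0. \<forall>n > N_0 CARD('d) \<alpha> cL cf' cf_lo cf_hi c0 h_hi.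
           sqrt (real CARD('d)) * h_hi n < r / 2 \<longrightarrow>
           (\<forall>x \<in> Box_plus r (sqrt (real CARD('d)) * h_hi n) \<inter> A_f cf' cf_lo cf_hi f.
              c * real n powr (- 1 / (2 + real CARD('d))) \<le>
              sqrt (\<integral>(X, \<omega>). \<bar>hist_density r (empirical n X) (hist_transform \<omega>) x - f x\<bar>\<^sup>2
                      \<partial>nu n P (transform_law MR (h_lo n) (h_hi n))))"
proof (intro exI conjI allI impI ballI)
  show "0 < sqrt (5 / 16 * cf_lo)" using cf_pos by simp
  fix n x
  assume n: "N_0 CARD('d) \<alpha> cL cf' cf_lo cf_hi c0 h_hi < n"
    and x: "x \<in> Box_plus r (sqrt (real CARD('d)) * h_hi n) \<inter> A_f cf' cf_lo cf_hi f"
  define h where "h = h_hi n"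
  define PH where "PH = transform_law MR (h_lo n) (h_hi n)"
  define Q where "Q = (\<Pi>\<^sub>M i\<in>{..<n}. P)"
  define err where "err = (\<lambda>X \<omega>. \<bar>hist_density r (empirical n X) (hist_transform \<omega>) x - f x\<bar>\<^sup>2)"
  have "1 \<le> CARD('d)" by (simp add: Suc_leI)
  note N_0 = N_0_bounds[OF this alpha(1) cL_pos cf_pos h_hi c0_away n]
  have n1: "1 \<le> n" "0 < n" using N_0(1) by auto
  have h: "0 < h" using n1 h_hi by (simp add: h_def)
  have rate: "h = real n powr (- 1 / (2 + real CARD('d)))" using n1 h_hi by (simp only: h_def)
  have "0 < c0 n * h_hi n" using c0_range[OF n1(1)] h by (simp add: h_def)
  then have h_lo: "0 < h_lo n" "h_lo n \<le> h_hi n" using h_order[OF n1(1)] h_le[OF n1(1)] by auto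
  have fx: "f x \<in> {cf_lo..cf_hi}" using x by (simp add: A_f_def)
  interpret Q: prob_space Q unfolding Q_def by (intro prob_space_PiM P_prob)
  interpret PH: prob_space PH unfolding PH_def by (rule prob_space_transform_law[OF MR h_lo])
  interpret pair: pair_sigma_finite Q PH ..
  interpret nu: prob_space "Q \<Otimes>\<^sub>M PH" by (rule prob_space_pair) unfold_locales
  have nu: "nu n P PH = Q \<Otimes>\<^sub>M PH" by (simp add: nu_def Q_def)
  have typical: "AE \<omega> in PH. rotation_matrix (fst \<omega>)
      \<and> (\<forall>i. 1 / h \<le> fst (snd \<omega>) $ i \<and> fst (snd \<omega>) $ i \<le> 1 / h_lo n)"
    unfolding PH_def h_def by (rule AE_transform_law[OF MR h_lo])
  have Box: "cball x (sqrt (real CARD('d)) * h) \<subseteq> Box r"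
    using x h by (intro cball_subset_Box) (auto simp: h_def)
  have meas: "case_prod err \<in> borel_measurable (Q \<Otimes>\<^sub>M PH)"
  proof -
    have "(\<lambda>(X, \<omega>). hist_density r (empirical n X) (hist_transform \<omega>) x) \<in> borel_measurable (Q \<Otimes>\<^sub>M PH)"
      unfolding nu[symmetric]
      by (rule measurable_hist_density_empirical[OF n1(2)])
         (simp_all add: P_density PH_def sets_transform_law[OF MR])
    then show ?thesis unfolding err_def by (simp add: case_prod_beta')
  qed
  \<comment> \<open>Integrability has to be checked, as the Bochner integral would otherwise be 0: almost every
    transform has bins of volume at least \<open>h_lo n ^ d\<close>, which bounds the error.\<close>
  have int: "integrable (Q \<Otimes>\<^sub>M PH) (case_prod err)"
  proof (rule nu.integrable_const_bound[OF _ meas])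
    define B where "B = 1 / h_lo n ^ CARD('d) + f x"
    have bound: "err X \<omega> \<le> B\<^sup>2" if \<omega>: "rotation_matrix (fst \<omega>)
        \<and> (\<forall>i. 1 / h \<le> fst (snd \<omega>) $ i \<and> fst (snd \<omega>) $ i \<le> 1 / h_lo n)" for X \<omega>
    proof -
      obtain R s b where w: "\<omega> = (R, s, b)" by (cases \<omega>)
      have R: "orthogonal_matrix R" and s: "\<And>i. 1 / h \<le> s $ i" "\<And>i. s $ i \<le> 1 / h_lo n"
        using \<omega> by (auto simp: w rotation_matrix_def)
      have s_pos: "0 < s $ i" for i using s(1)[of i] h by (meson less_le_trans zero_less_divide_1_iff)
      have "(\<Prod>i\<in>(UNIV::'d set). h_lo n) \<le> (\<Prod>i\<in>UNIV. 1 / s $ i)"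
      proof (intro prod_mono conjI)
        fix i show "0 \<le> h_lo n" using h_lo by simp
        show "h_lo n \<le> 1 / s $ i" using s(2)[of i] s_pos[of i] h_lo by (simp add: field_simps)
      qed
      moreover have "bin (hist_transform \<omega>) x \<inter> Box r = bin (hist_transform \<omega>) x"
        using bin_subset_cball[OF R s(1) h, of b x] Box by (auto simp: w)
      ultimately have "h_lo n ^ CARD('d) \<le> measure lborel (bin (hist_transform \<omega>) x \<inter> Box r)"
        using measure_bin[OF R s_pos, of b x] by (simp add: w)
      then have "hist_density r (empirical n X) (hist_transform \<omega>) x \<in> {0..1 / h_lo n ^ CARD('d)}"
        using h_lo by (intro hist_density_empirical_le n1) auto
      then have "\<bar>hist_density r (empirical n X) (hist_transform \<omega>) x - f x\<bar> \<le> B"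
        using fx cf_pos by (auto simp: B_def abs_le_iff)
      then show ?thesis unfolding err_def by (intro power_mono) auto
    qed
    have "AE z in Q \<Otimes>\<^sub>M PH. rotation_matrix (fst (snd z))
        \<and> (\<forall>i. 1 / h \<le> fst (snd (snd z)) $ i \<and> fst (snd (snd z)) $ i \<le> 1 / h_lo n)"
      by (rule AE_pair_snd[OF PH.sigma_finite_measure_axioms typical])
    then show "AE z in Q \<Otimes>\<^sub>M PH. norm (case_prod err z) \<le> B\<^sup>2"
      by eventually_elim (use bound in \<open>auto simp: case_prod_beta err_def\<close>)
  qed
  have "5 / 16 * cf_lo / (real n * h ^ CARD('d)) \<le> (\<integral>\<omega>. \<integral>X. err X \<omega> \<partial>Q \<partial>PH)"
  proof (rule PH.integral_ge_const)
    show "integrable PH (\<lambda>\<omega>. \<integral>X. err X \<omega> \<partial>Q)" by (rule pair.integrable_snd[OF int])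
    show "AE \<omega> in PH. 5 / 16 * cf_lo / (real n * h ^ CARD('d)) \<le> (\<integral>X. err X \<omega> \<partial>Q)"
      using typical
    proof eventually_elim
      case (elim \<omega>)
      obtain R s b where w: "\<omega> = (R, s, b)" by (cases \<omega>)
      show ?case
        unfolding err_def Q_def w
        by (rule mean_square_error_given_transform[OF f_meas P_density P_prob f_C1 cL_pos h,
              where hi = cf_hi])
           (use elim N_0(2,3) x fx cf_pos n1 in \<open>auto simp: w rotation_matrix_def h_def\<close>)
    qed
  qed
  also have "(\<integral>\<omega>. \<integral>X. err X \<omega> \<partial>Q \<partial>PH) = integral\<^sup>L (Q \<Otimes>\<^sub>M PH) (case_prod err)"
    by (rule pair.integral_snd[OF int])
  finally have mse: "5 / 16 * cf_lo / (real n * h ^ CARD('d)) \<le> integral\<^sup>L (Q \<Otimes>\<^sub>M PH) (case_prod err)" .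
  \<comment> \<open>The bandwidth \<open>n powr (- 1 / (2 + d))\<close> is the one for which \<open>1 / (n h\<^sup>d) = h\<^sup>2\<close>.\<close>
  have "real n * h ^ (CARD('d) + 2) = 1"
  proof -
    have "h ^ (CARD('d) + 2) = h powr (2 + real CARD('d))"
      using h powr_realpow[of h "CARD('d) + 2"] by (simp add: add.commute)
    also have "\<dots> = real n powr (- 1 / (2 + real CARD('d)) * (2 + real CARD('d)))"
      using n1 by (simp only: h_def h_hi powr_powr)
    also have "- 1 / (2 + real CARD('d)) * (2 + real CARD('d)) = - 1" by simp
    finally show ?thesis using n1 by (simp add: powr_minus_divide)
  qed
  then have "real n * h ^ CARD('d) * h\<^sup>2 = 1" by (simp add: power2_eq_square ac_simps)
  then have "1 / (real n * h ^ CARD('d)) = h\<^sup>2" using h n1 by (simp add: field_simps)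
  then have "5 / 16 * cf_lo / (real n * h ^ CARD('d)) = 5 / 16 * cf_lo * h\<^sup>2"
    by (metis times_divide_eq_right mult.right_neutral)
  with mse have "5 / 16 * cf_lo * h\<^sup>2 \<le> integral\<^sup>L (Q \<Otimes>\<^sub>M PH) (case_prod err)" by (simp only:)
  then have "sqrt (5 / 16 * cf_lo * h\<^sup>2) \<le> sqrt (integral\<^sup>L (Q \<Otimes>\<^sub>M PH) (case_prod err))"
    by (rule real_sqrt_le_mono)
  moreover have "sqrt (5 / 16 * cf_lo * h\<^sup>2) = sqrt (5 / 16 * cf_lo) * h"
    using h by (simp only: real_sqrt_mult real_sqrt_abs abs_of_pos)
  ultimately have "sqrt (5 / 16 * cf_lo) * h \<le> sqrt (integral\<^sup>L (Q \<Otimes>\<^sub>M PH) (case_prod err))"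
    by (simp only:)
  then show "sqrt (5 / 16 * cf_lo) * real n powr (- 1 / (2 + real CARD('d)))
      \<le> sqrt (\<integral>(X, \<omega>). \<bar>hist_density r (empirical n X) (hist_transform \<omega>) x - f x\<bar>\<^sup>2
                \<partial>nu n P (transform_law MR (h_lo n) (h_hi n)))"
    unfolding PH_def[symmetric] nu err_def rate .
qed

end
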